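(* Let $p$ be a prime, let $r$ be a power of $p$, let $m\ge 1$ be an integer, and put $q=r^m$, with $\mathbb F_r\subset\mathbb F_q\subset\overline{\mathbb F}_p$. For $0\le i\le m-1$ let $a_i\in\mathbb F_q$ and let $f_i\in\mathbb F_r[X]$ be a $q$-linearized polynomial. Let $M$ be the $m\times m$ matrix with entries in the commutative ring $(R_q,+,\circ)$ given by $$M=\begin{bmatrix} a_0f_0& a_1f_1&\cdots& a_{m-1}f_{m-1}\\ a_{m-1}^rf_{m-1}\circ X^q& a_0^rf_0&\cdots&a_{m-2}^rf_{m-2}\\ \vdots&\vdots&&\vdots\\ a_1^{r^{m-1}}f_1\circ X^q& a_2^{r^{m-1}}f_2\circ X^q&\cdots&a_0^{r^{m-1}}f_0 \end{bmatrix},$$ that is, for $0\le i,j\le m-1$ the $(i,j)$ entry of $M$ is $a_{j-i}^{r^i}f_{j-i}$ if $i\le j$, and $a_{m+j-i}^{r^i}\,f_{m+j-i}\circ X^q$ if $i>j$. Let $\det M\in R_q$ be its determinant, computed in the ring $(R_q,+,\circ)$. If $z\in\overline{\mathbb F}_p$ satisfies $$\sum_{i=0}^{m-1}a_i\,f_i(z)^{r^i}=0,$$ then $$(\det M)(z)=0,$$ where $\det M$ is a $q$-linearized polynomial over $\mathbb F_r$ (i.e. all of its coefficients lie in $\mathbb F_r$).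
   Context: $\overline{\mathbb F}_p$ is the algebraic closure of $\mathbb F_p$, and all finite fields are viewed inside it. For a prime power $q$ of $p$, a $q$-linearized polynomial over a field $K\subset\overline{\mathbb F}_p$ is a polynomial of the form $\sum_{i=0}^n c_iX^{q^i}$ with $c_i\in K$. $R_q$ denotes the set of all $q$-linearized polynomials over $\mathbb F_q$; with ordinary addition $+$ and composition $\circ$ as multiplication, $(R_q,+,\circ)$ is a commutative ring with identity $X$. For $a\in\mathbb F_q$ and $f\in R_q$, $af$ denotes the ordinary scalar multiple. The products occurring in the determinant of a matrix over $R_q$ are therefore compositions. *)

theory Defs
  imports
    "HOL-Algebra.Algebraic_Closure_Type"
    "HOL-Combinatorics.Permutations"
    "Berlekamp_Zassenhaus.Finite_Field"
begin

text \<open>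
  The prime field with p elements is \<open>'p mod_ring\<close> with \<open>p = CARD('p)\<close>; all finite fields of
  characteristic p live inside its algebraic closure \<open>'p mod_ring alg_closure\<close>. For a power q of
  p, \<open>GF q\<close> is the unique subfield with q elements, see \<open>subfield_card_iff_GF\<close> below.
\<close>

definition GF :: "nat \<Rightarrow> 'p::prime_card mod_ring alg_closure set" where
  "GF q = {x. x ^ q = x}"

definition linearized_polys :: "nat \<Rightarrow> 'a::comm_ring_1 set \<Rightarrow> 'a poly set" where
  "linearized_polys q K = {(\<Sum>i\<le>n. monom (c i) (q ^ i)) | n c. \<forall>i\<le>n. c i \<in> K}"

definition linearized_ring :: "nat \<Rightarrow> 'p::prime_card mod_ring alg_closure poly ring" where
  "linearized_ring q =
     \<lparr>carrier = linearized_polys q (GF q), monoid.mult = pcompose, one = [:0, 1:],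
      zero = 0, add = (+)\<rparr>"

text \<open>
  The Leibniz formula over a commutative ring in the sense of HOL-Algebra; only the entries with
  indices below m matter. The library determinants require a type class instance, whereas
  \<open>linearized_ring q\<close> depends on the number q; that it is a commutative ring is
  \<open>cring_linearized_ring\<close> below.
\<close>

definition ring_det :: "('a, 'b) ring_scheme \<Rightarrow> nat \<Rightarrow> (nat \<Rightarrow> nat \<Rightarrow> 'a) \<Rightarrow> 'a" where
  "ring_det R m M =
     (\<Oplus>\<^bsub>R\<^esub>\<sigma>\<in>{\<sigma>. \<sigma> permutes {..<m}}.
        (if evenperm \<sigma> then \<one>\<^bsub>R\<^esub> else \<ominus>\<^bsub>R\<^esub> \<one>\<^bsub>R\<^esub>) \<otimes>\<^bsub>R\<^esub> (\<Otimes>\<^bsub>R\<^esub>i\<in>{..<m}. M i (\<sigma> i)))"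


lemma add_power_closure:
  fixes x y :: "'p::prime_card mod_ring alg_closure"
  shows "(x + y) ^ CARD('p) ^ n = x ^ CARD('p) ^ n + y ^ CARD('p) ^ n"
  by (rule freshmans_dream') (use prime_card[where 'a='p] in auto)

lemma minus_power_closure:
  fixes x :: "'p::prime_card mod_ring alg_closure"
  shows "(- x) ^ CARD('p) ^ n = - (x ^ CARD('p) ^ n)"
proof -
  have "CARD('p) ^ n > 0" using prime_card[where 'a='p] prime_gt_0_nat by simp
  then show ?thesis
    using add_power_closure[of x "- x" n] by (simp add: add_eq_0_iff power_0_left)
qed

lemma GF_closed:
  fixes x y :: "'p::prime_card mod_ring alg_closure"
  assumes q: "q = CARD('p) ^ n" "n \<ge> 1"
  shows "0 \<in> (GF q :: 'p mod_ring alg_closure set)" "1 \<in> (GF q :: 'p mod_ring alg_closure set)"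
    "x \<in> GF q \<Longrightarrow> - x \<in> GF q" "x \<in> GF q \<Longrightarrow> inverse x \<in> GF q"
    "x \<in> GF q \<Longrightarrow> y \<in> GF q \<Longrightarrow> x + y \<in> GF q"
    "x \<in> GF q \<Longrightarrow> y \<in> GF q \<Longrightarrow> x * y \<in> GF q"
proof -
  have "q > 0" using prime_card[where 'a='p] prime_gt_0_nat q by simp
  then show "0 \<in> (GF q :: 'p mod_ring alg_closure set)" by (simp add: GF_def power_0_left)
qed (simp_all add: GF_def q add_power_closure minus_power_closure power_mult_distrib power_inverse)

lemma card_GF:
  assumes q: "q = CARD('p) ^ n" "n \<ge> 1"
  shows "card (GF q :: 'p::prime_card mod_ring alg_closure set) = q"
    and "finite (GF q :: 'p mod_ring alg_closure set)"
proof -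
  let ?X = "[:0, 1:] :: 'p mod_ring alg_closure poly"
  define P where "P = monom 1 q - ?X"
  have p2: "CARD('p) \<ge> 2" using prime_card[where 'a='p] prime_ge_2_nat by blast
  have q2: "q \<ge> 2"
    using p2 q self_le_power[of "CARD('p)" n] by auto
  have roots: "{x. poly P x = 0} = GF q"
    by (auto simp: P_def GF_def poly_monom)
  have deg: "degree P = q"
  proof -
    have "degree (monom 1 q + (- ?X)) = degree (monom (1 :: 'p mod_ring alg_closure) q)"
      by (rule degree_add_eq_left) (use q2 in \<open>simp add: degree_monom_eq\<close>)
    then show ?thesis unfolding P_def diff_conv_add_uminus by (metis degree_monom_eq one_neq_zero)
  qed
  have P0: "P \<noteq> 0" using deg q2 by auto
  show "finite (GF q :: 'p mod_ring alg_closure set)"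
    using poly_roots_finite[OF P0] roots by simp
  have q0: "of_nat q = (0 :: 'p mod_ring alg_closure)"
    using q by (simp add: of_nat_eq_0_iff_char_dvd)
  have pd: "pderiv P = - 1"
    by (simp add: P_def pderiv_diff pderiv_monom q0 pderiv_pCons one_pCons)
  have simple: "order x P = 1" if "poly P x = 0" for x
  proof -
    have "\<not> 2 \<le> order x P"
    proof
      assume "2 \<le> order x P"
      then have "[:- x, 1:] ^ 2 dvd P" using order_divides by blast
      then obtain h where h: "P = [:- x, 1:] * ([:- x, 1:] * h)"
        by (metis dvdE power2_eq_square mult.assoc)
      have "poly (pderiv P) x = 0"
        unfolding h pderiv_mult by simp
      then show False by (simp add: pd)
    qed
    moreover have "order x P \<noteq> 0" using that P0 by (simp add: order_root)
    ultimately show ?thesis by linarith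
  qed
  obtain A where A: "size A = degree P" "P = smult (lead_coeff P) (\<Prod>x\<in>#A. [:- x, 1:])"
    using alg_closed_imp_factorization[OF P0] by blast
  have ord: "order x (\<Prod>x\<in>#B. [:- x, 1:]) = count B x" for B and x :: "'p mod_ring alg_closure"
  proof (induction B)
    case (add b B)
    have "(\<Prod>x\<in>#B. [:- x, 1:]) \<noteq> 0" by (auto simp: prod_mset_zero_iff)
    then have "order x ([:- b, 1:] * (\<Prod>x\<in>#B. [:- x, 1:]))
               = order x [:- b, 1:] + order x (\<Prod>x\<in>#B. [:- x, 1:])"
      by (intro order_mult) (simp only: mult_eq_0_iff, simp)
    moreover have "order x [:- b, 1:] = (if x = b then 1 else 0)"
      using order_0I[of "[:- b, 1:]" x] order_power_n_n[of b 1] by auto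
    ultimately show ?case using add.IH by auto
  qed auto
  have count: "count A x = order x P" for x
    by (subst A(2)) (use P0 in \<open>simp add: order_smult ord\<close>)
  have "A = mset_set (GF q)"
  proof (rule multiset_eqI)
    fix x
    show "count A x = count (mset_set (GF q)) x"
    proof (cases "poly P x = 0")
      case True
      then have "x \<in> GF q" using roots by blast
      then show ?thesis using count simple[OF True] \<open>finite (GF q)\<close> by simp
    next
      case False
      then have "x \<notin> GF q" using roots by blast
      then show ?thesis using count order_0I[OF False] by simp
    qed
  qed
  then show "card (GF q :: 'p mod_ring alg_closure set) = q"
    using A(1) deg by simp
qed

lemma subfield_card_iff_GF:
  fixes K :: "'p::prime_card mod_ring alg_closure set"
  assumes q: "q = CARD('p) ^ n" "n \<ge> 1"
  shows "subfield K ring_of_type_algebra \<and> card K = q \<longleftrightarrow> K = GF q"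
proof -
  let ?L = "ring_of_type_algebra :: 'p mod_ring alg_closure ring"
  interpret L: Ring.field ?L by (rule field_from_type_algebra)
  have sel: "carrier ?L = UNIV" "x \<otimes>\<^bsub>?L\<^esub> y = x * y" "x \<oplus>\<^bsub>?L\<^esub> y = x + y"
    "\<zero>\<^bsub>?L\<^esub> = 0" "\<one>\<^bsub>?L\<^esub> = 1" for x y
    by (simp_all add: ring_of_type_algebra_def)
  have neg: "\<ominus>\<^bsub>?L\<^esub> x = - x" for x
    using L.minus_equality[of "- x" x] by (simp add: sel)
  have inv: "inv\<^bsub>?L\<^esub> x = inverse x" if "x \<noteq> 0" for x
    using L.inv_unique'[of x "inverse x"] that by (simp add: sel)
  have pow: "x [^]\<^bsub>?L\<^esub> (k::nat) = x ^ k" for x k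
    by (induction k) (simp_all add: sel mult.commute)
  show ?thesis
  proof
    assume K: "K = GF q"
    have "subfield K ?L"
    proof (rule L.subfieldI')
      show "subring K ?L"
        by (rule L.subringI) (auto simp: K sel neg GF_closed[OF q])
      show "\<And>k. k \<in> K - {\<zero>\<^bsub>?L\<^esub>} \<Longrightarrow> inv\<^bsub>?L\<^esub> k \<in> K"
        by (auto simp: K sel inv GF_closed[OF q])
    qed
    then show "subfield K ?L \<and> card K = q" using card_GF[OF q] K by simp
  next
    assume K: "subfield K ?L \<and> card K = q"
    have q0: "q > 0" using prime_card[where 'a='p] prime_gt_0_nat q by simp
    then have fin: "finite K" using K card_ge_0_finite by metis
    note Kf = subfield.axioms(1)[OF conjunct1[OF K]]
    have "K \<subseteq> GF q"
    proof
      fix x assume x: "x \<in> K"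
      show "x \<in> GF q"
      proof (cases "x = 0")
        case False
        let ?S = "K - {0}"
        have zK: "0 \<in> K"
          using subringE(2)[OF subfieldE(1)[OF conjunct1[OF K]]] by (simp add: sel)
        have mK: "y * z \<in> K" if "y \<in> K" "z \<in> K" for y z
          using subringE(6)[OF subfieldE(1)[OF conjunct1[OF K]] that] by (simp add: sel)
        have "bij_betw ((*) x) ?S ?S"
          unfolding bij_betw_def
        proof
          show inj: "inj_on ((*) x) ?S" using False by (auto simp: inj_on_def)
          show "(*) x ` ?S = ?S"
            by (rule endo_inj_surj) (use fin inj mK x False in auto)
        qed
        then have "(\<Prod>y\<in>?S. x * y) = \<Prod>?S"
          by (rule prod.reindex_bij_betw)
        then have "x ^ card ?S * \<Prod>?S = \<Prod>?S"
          by (simp add: prod.distrib)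
        moreover have "\<Prod>?S \<noteq> 0" using fin by (simp add: prod_zero_iff)
        ultimately have "x ^ card ?S = 1" by simp
        moreover have "q = Suc (card ?S)" using K zK fin q0 by (simp add: card_Diff_singleton)
        ultimately show ?thesis by (simp add: GF_def)
      qed (use GF_closed[OF q] in auto)
    qed
    then show "K = GF q"
      using card_subset_eq[OF card_GF(2)[OF q]] card_GF(1)[OF q] K by metis
  qed
qed

lemma linearized_polys_iff:
  assumes "q \<ge> 2" "0 \<in> K"
  shows "f \<in> linearized_polys q K \<longleftrightarrow> (\<forall>k. coeff f k \<in> K \<and> (coeff f k \<noteq> 0 \<longrightarrow> (\<exists>i. k = q ^ i)))"
proof
  assume "f \<in> linearized_polys q K"
  then obtain n c where f: "f = (\<Sum>i\<le>n. monom (c i) (q ^ i))" and c: "\<forall>i\<le>n. c i \<in> K"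
    by (auto simp: linearized_polys_def)
  have cf: "coeff f k = (\<Sum>i\<le>n. if q ^ i = k then c i else 0)" for k
    by (simp add: f coeff_sum)
  show "\<forall>k. coeff f k \<in> K \<and> (coeff f k \<noteq> 0 \<longrightarrow> (\<exists>i. k = q ^ i))"
  proof
    fix k
    show "coeff f k \<in> K \<and> (coeff f k \<noteq> 0 \<longrightarrow> (\<exists>i. k = q ^ i))"
    proof (cases "\<exists>j. k = q ^ j")
      case True
      then obtain j where j: "k = q ^ j" by blast
      have "coeff f k = (\<Sum>i\<le>n. if i = j then c i else 0)"
        unfolding cf j using assms(1) by (intro sum.cong) auto
      also have "\<dots> = (if j \<le> n then c j else 0)" by simp
      finally show ?thesis using c j assms(2) by auto
    next
      case False
      then have "coeff f k = 0" unfolding cf by (intro sum.neutral) auto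
      then show ?thesis using assms(2) by auto
    qed
  qed
next
  assume *: "\<forall>k. coeff f k \<in> K \<and> (coeff f k \<noteq> 0 \<longrightarrow> (\<exists>i. k = q ^ i))"
  have eq: "f = (\<Sum>i\<le>degree f. monom (coeff f (q ^ i)) (q ^ i))"
  proof (rule poly_eqI)
    fix k
    have cf: "coeff (\<Sum>i\<le>degree f. monom (coeff f (q ^ i)) (q ^ i)) k
               = (\<Sum>i\<le>degree f. if q ^ i = k then coeff f (q ^ i) else 0)"
      by (simp add: coeff_sum)
    show "coeff f k = coeff (\<Sum>i\<le>degree f. monom (coeff f (q ^ i)) (q ^ i)) k"
    proof (cases "coeff f k = 0")
      case True
      then have "(\<Sum>i\<le>degree f. if q ^ i = k then coeff f (q ^ i) else 0) = 0"
        by (intro sum.neutral) auto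
      then show ?thesis using True cf by simp
    next
      case False
      then obtain j where j: "k = q ^ j" using * by blast
      have "j < q ^ j" using assms(1) by (simp add: power_gt_expt)
      also have "q ^ j \<le> degree f" using False j le_degree by blast
      finally have "j \<le> degree f" by simp
      moreover have "(\<Sum>i\<le>degree f. if q ^ i = k then coeff f (q ^ i) else 0)
            = (\<Sum>i\<le>degree f. if i = j then coeff f (q ^ i) else 0)"
        unfolding j using assms(1) by (intro sum.cong) auto
      ultimately show ?thesis using cf j by simp
    qed
  qed
  show "f \<in> linearized_polys q K"
    unfolding linearized_polys_def
    by (rule CollectI, rule exI[of _ "degree f"], rule exI[of _ "\<lambda>i. coeff f (q ^ i)"],
        rule conjI, rule eq) (use * in blast)
qed

lemma pcompose_monom_left: "pcompose (monom c n) g = smult c (g ^ n)"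
proof (induction n)
  case (Suc n)
  then show ?case by (simp add: monom_Suc pcompose_pCons)
qed (simp add: monom_0)

lemma GF_pow_pow: "x \<in> GF q \<Longrightarrow> x ^ q ^ i = x"
  by (induction i) (simp_all add: GF_def power_mult)

lemma pcompose_linearized:
  fixes c d :: "nat \<Rightarrow> 'p::prime_card mod_ring alg_closure"
  assumes q: "q = CARD('p) ^ e" and d: "\<forall>j\<le>l. d j \<in> GF q"
  shows "pcompose (\<Sum>i\<le>n. monom (c i) (q ^ i)) (\<Sum>j\<le>l. monom (d j) (q ^ j))
         = (\<Sum>i\<le>n. \<Sum>j\<le>l. monom (c i * d j) (q ^ (i + j)))"
proof -
  have *: "(\<Sum>j\<le>l. monom (d j) (q ^ j)) ^ q ^ i = (\<Sum>j\<le>l. monom (d j) (q ^ (i + j)))" for i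
  proof -
    have "(\<Sum>j\<le>l. monom (d j) (q ^ j)) ^ q ^ i = (\<Sum>j\<le>l. monom (d j) (q ^ j) ^ q ^ i)"
      by (rule freshmans_dream_sum'[where n = "e * i"])
         (use prime_card[where 'a='p] in \<open>auto simp: q power_mult\<close>)
    also have "\<dots> = (\<Sum>j\<le>l. monom (d j) (q ^ (i + j)))"
      using d by (intro sum.cong) (auto simp: monom_power GF_pow_pow power_add mult.commute)
    finally show ?thesis .
  qed
  show ?thesis
    by (simp add: pcompose_sum pcompose_monom_left * smult_sum2 smult_monom)
qed

lemma cring_linearized_ring:
  assumes q: "q = CARD('p) ^ n" "n \<ge> 1"
  shows "cring (linearized_ring q :: 'p::prime_card mod_ring alg_closure poly ring)"
proof -
  let ?G = "GF q :: 'p mod_ring alg_closure set"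
  have p2: "CARD('p) \<ge> 2" using prime_card[where 'a='p] prime_ge_2_nat by blast
  have q2: "q \<ge> 2"
    using p2 q self_le_power[of "CARD('p)" n] by auto
  note G = GF_closed[where 'p='p, OF q]
  note iff = linearized_polys_iff[OF q2 G(1)]
  have add: "f + g \<in> linearized_polys q ?G"
    if "f \<in> linearized_polys q ?G" "g \<in> linearized_polys q ?G" for f g
    using that G(5) unfolding iff coeff_add by (metis add.right_neutral add_0)
  have sum: "(\<Sum>i\<in>I. h i) \<in> linearized_polys q ?G"
    if "\<And>i. i \<in> I \<Longrightarrow> h i \<in> linearized_polys q ?G" for h and I :: "nat set"
    using that by (induction I rule: infinite_finite_induct) (auto simp: add, auto simp: iff G)
  have mon: "monom c (q ^ i) \<in> linearized_polys q ?G" if "c \<in> ?G" for c i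
    using that G(1) unfolding iff by auto
  have comp: "pcompose f g \<in> linearized_polys q ?G \<and> pcompose f g = pcompose g f"
    if fg: "f \<in> linearized_polys q ?G" "g \<in> linearized_polys q ?G" for f g
  proof -
    obtain n c where f: "f = (\<Sum>i\<le>n. monom (c i) (q ^ i))" and c: "\<forall>i\<le>n. c i \<in> GF q"
      using fg(1) by (auto simp: linearized_polys_def)
    obtain l d where g: "g = (\<Sum>i\<le>l. monom (d i) (q ^ i))" and d: "\<forall>i\<le>l. d i \<in> GF q"
      using fg(2) by (auto simp: linearized_polys_def)
    have 1: "pcompose f g = (\<Sum>i\<le>n. \<Sum>j\<le>l. monom (c i * d j) (q ^ (i + j)))"
      unfolding f g by (rule pcompose_linearized[OF q(1) d])
    have 2: "pcompose g f = (\<Sum>i\<le>l. \<Sum>j\<le>n. monom (d i * c j) (q ^ (i + j)))"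
      unfolding f g by (rule pcompose_linearized[OF q(1) c])
    have "pcompose f g = pcompose g f"
      unfolding 1 2 by (subst sum.swap) (simp add: mult.commute add.commute)
    moreover have "pcompose f g \<in> linearized_polys q ?G"
      unfolding 1 by (intro sum mon G(6)) (use c d in auto)
    ultimately show ?thesis by blast
  qed
  show ?thesis
  proof (rule cringI)
    show "abelian_group (linearized_ring q :: 'p mod_ring alg_closure poly ring)"
    proof (rule abelian_groupI)
      fix f assume f: "f \<in> carrier (linearized_ring q :: 'p mod_ring alg_closure poly ring)"
      have "- f \<in> linearized_polys q ?G"
        using f G(3) by (auto simp: linearized_ring_def iff)
      then show "\<exists>y\<in>carrier (linearized_ring q). y \<oplus>\<^bsub>linearized_ring q\<^esub> f = \<zero>\<^bsub>linearized_ring q\<^esub>"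
        by (intro bexI[of _ "- f"]) (auto simp: linearized_ring_def)
    qed (auto simp: linearized_ring_def add add_ac, auto simp: iff G)
    show "comm_monoid (linearized_ring q :: 'p mod_ring alg_closure poly ring)"
    proof (rule comm_monoidI)
      show "\<one>\<^bsub>linearized_ring q\<^esub> \<in> carrier (linearized_ring q :: 'p mod_ring alg_closure poly ring)"
        using mon[of 1 0] G(2) by (simp add: linearized_ring_def monom_altdef)
      show "f \<otimes>\<^bsub>linearized_ring q\<^esub> g = g \<otimes>\<^bsub>linearized_ring q\<^esub> f"
        if "f \<in> carrier (linearized_ring q)" "g \<in> carrier (linearized_ring q)"
        for f g :: "'p mod_ring alg_closure poly"
        using that comp[of f g] by (simp add: linearized_ring_def)
      show "f \<otimes>\<^bsub>linearized_ring q\<^esub> g \<in> carrier (linearized_ring q)"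
        if "f \<in> carrier (linearized_ring q)" "g \<in> carrier (linearized_ring q)"
        for f g :: "'p mod_ring alg_closure poly"
        using conjunct1[OF comp[of f g]] that by (simp add: linearized_ring_def)
    qed (simp_all add: linearized_ring_def pcompose_assoc pcompose_pCons)
  qed (auto simp: linearized_ring_def pcompose_add)
qed

end

theory Submission
  imports Defs "Jordan_Normal_Form.Char_Poly"
begin

text \<open>
  Raising \<open>\<Sum>\<^sub>k a\<^sub>k f\<^sub>k(z)\<^bsup>r\<^sup>k\<^esup> = 0\<close> to the power \<open>r\<^sup>i\<close>, and using that the \<open>f\<^sub>k\<close> have coefficients
  in \<open>GF r\<close> and so commute with \<open>r\<close>-th powers, gives
  \<open>\<Sum>\<^sub>k a\<^sub>k\<^bsup>r\<^sup>i\<^esup> f\<^sub>k(z\<^bsup>r\<^sup>(k+i)\<^esup>) = 0\<close>. When \<open>k + i \<ge> m\<close> the argument is the \<open>q\<close>-th power of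
  \<open>z\<^bsup>r\<^sup>(k+i-m)\<^esup>\<close>, which accounts for the composition with \<open>X\<^sup>q\<close> below the diagonal. So the
  matrix \<open>M\<close>, whose entries act on the algebraic closure by evaluation, kills the column
  \<open>(z, z\<^sup>r, z\<^bsup>r\<^sup>2\<^esup>, \<dots>)\<close>. Multiplying by the adjugate, \<open>det M\<close> kills each entry of this
  column, in particular \<open>z\<close> (\<open>det_annihilates_kernel\<close>).

  For determinants and adjugates over a commutative ring type, the commutative ring of
  linearized polynomials over \<open>GF q\<close> is replaced by the isomorphic ring of ordinary polynomials
  over \<open>GF q\<close>, in which \<open>T\<^sup>i\<close> corresponds to \<open>X\<^bsup>q\<^sup>i\<^esup>\<close> (\<open>q_associate_mult\<close>,
  \<open>ring_det_q_associate\<close>). Let \<open>N\<close> be the matrix over \<open>GF q[T]\<close> corresponding to \<open>M\<close>.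

  That \<open>det N\<close> has coefficients in \<open>GF r\<close> is Galois descent. Let \<open>F\<close> raise all coefficients to
  the power \<open>r\<close>. Since \<open>a\<^sub>k\<^bsup>r\<^sup>m\<^esup> = a\<^sub>k\<close>, the matrix \<open>F N\<close> arises from \<open>N\<close> by moving rows and columns
  cyclically by one place, up to factors \<open>T\<close> caused by the wrap-around. Precisely,
  \<open>S N = (F N) S\<close> for the cyclic shift matrix \<open>S\<close> with \<open>T\<close> in its corner. Taking determinants
  and cancelling \<open>det S \<noteq> 0\<close> shows that \<open>F\<close> fixes \<open>det N\<close> (\<open>det_over_GF_if_shift_commutes\<close>).
\<close>

section \<open>Polynomials with coefficients in a finite field\<close>

definition polys_over :: "'a::zero set \<Rightarrow> 'a poly set" where
  "polys_over K = {h. \<forall>i. coeff h i \<in> K}"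

lemma GF_mono_power: "x \<in> GF r \<Longrightarrow> x \<in> GF (r ^ m)"
  using GF_pow_pow[of x r m] by (simp add: GF_def)

lemma GF_power_closed: "x \<in> GF q \<Longrightarrow> x ^ k \<in> GF q"
  by (simp add: GF_def flip: power_mult) (simp add: mult.commute[of k] power_mult)

context
  fixes q n :: nat
  assumes q: "q = CARD('p::prime_card) ^ n" "n \<ge> 1"
begin

lemma GF_sum_closed:
  fixes h :: "'b \<Rightarrow> 'p mod_ring alg_closure"
  assumes "\<And>i. i \<in> I \<Longrightarrow> h i \<in> GF q"
  shows "sum h I \<in> GF q"
  using assms by (induction I rule: infinite_finite_induct) (auto simp: GF_closed[OF q])

lemma polys_over_GF_closed:
  fixes h k :: "'p mod_ring alg_closure poly"
  shows "0 \<in> polys_over (GF q :: 'p mod_ring alg_closure set)"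
    "1 \<in> polys_over (GF q :: 'p mod_ring alg_closure set)"
    "[:0, 1:] \<in> polys_over (GF q :: 'p mod_ring alg_closure set)"
    "h \<in> polys_over (GF q) \<Longrightarrow> - h \<in> polys_over (GF q)"
    "h \<in> polys_over (GF q) \<Longrightarrow> k \<in> polys_over (GF q) \<Longrightarrow> h + k \<in> polys_over (GF q)"
    "h \<in> polys_over (GF q) \<Longrightarrow> k \<in> polys_over (GF q) \<Longrightarrow> h * k \<in> polys_over (GF q)"
    "c \<in> GF q \<Longrightarrow> h \<in> polys_over (GF q) \<Longrightarrow> smult c h \<in> polys_over (GF q)"
  by (auto simp: polys_over_def GF_closed[OF q] coeff_mult coeff_pCons coeff_1
      intro!: GF_sum_closed split: nat.split)

lemma polys_over_GF_prod_closed: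
  fixes h :: "'b \<Rightarrow> 'p mod_ring alg_closure poly"
  assumes "\<And>i. i \<in> I \<Longrightarrow> h i \<in> polys_over (GF q)"
  shows "prod h I \<in> polys_over (GF q)"
  using assms
  by (induction I rule: infinite_finite_induct) (auto simp: polys_over_GF_closed)

end

section \<open>Linearized polynomials as ordinary polynomials\<close>

text \<open>
  The usual name is the linearized \<open>q\<close>-associate of \<open>h\<close>: the exponent \<open>i\<close> is turned into \<open>q\<^sup>i\<close>.
\<close>

definition q_associate :: "nat \<Rightarrow> 'a::comm_ring_1 poly \<Rightarrow> 'a poly" where
  "q_associate q h = (\<Sum>i\<le>degree h. monom (coeff h i) (q ^ i))"

text \<open>
  A summation bound common to several polynomials is what makes additivity a termwise statement.
\<close>

lemma q_associate_eq_sum: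
  assumes "degree h \<le> n"
  shows "q_associate q h = (\<Sum>i\<le>n. monom (coeff h i) (q ^ i))"
  unfolding q_associate_def
  by (rule sum.mono_neutral_left) (use assms in \<open>auto simp: coeff_eq_0\<close>)

lemma q_associate_0 [simp]: "q_associate q 0 = 0"
  by (simp add: q_associate_def)

lemma q_associate_add: "q_associate q (h + k) = q_associate q h + q_associate q k"
proof -
  let ?n = "max (degree h) (degree k)"
  show ?thesis
    using q_associate_eq_sum[of h ?n q] q_associate_eq_sum[of k ?n q]
      q_associate_eq_sum[of "h + k" ?n q] degree_add_le_max[of h k]
    by (simp add: sum.distrib flip: add_monom)
qed

lemma q_associate_uminus: "q_associate q (- h) = - q_associate q h"
  by (simp add: q_associate_def sum_negf flip: minus_monom)

lemma q_associate_smult: "q_associate q (smult c h) = smult c (q_associate q h)"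
proof -
  have "q_associate q (smult c h) = (\<Sum>i\<le>degree h. monom (coeff (smult c h) i) (q ^ i))"
    by (rule q_associate_eq_sum) (rule degree_smult_le)
  then show ?thesis by (simp add: q_associate_def smult_sum2 smult_monom)
qed

lemma q_associate_sum: "q_associate q (sum h I) = (\<Sum>i\<in>I. q_associate q (h i))"
  by (induction I rule: infinite_finite_induct) (simp_all add: q_associate_add)

lemma q_associate_monom: "q_associate q (monom c i) = monom c (q ^ i)"
proof -
  have "q_associate q (monom c i) = (\<Sum>j\<le>i. if i = j then monom c (q ^ j) else 0)"
    by (subst q_associate_eq_sum[OF degree_monom_le]) (intro sum.cong, auto)
  then show ?thesis by simp
qed

lemma q_associate_1: "q_associate q 1 = [:0, 1:]"
  using q_associate_monom[of q 1 0] by (simp add: monom_altdef one_pCons)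

lemma q_associate_X: "q_associate q [:0, 1:] = monom 1 q"
  using q_associate_monom[of q 1 1] by (simp add: monom_altdef)

lemma linearized_polys_eq_image:
  assumes "0 \<in> K"
  shows "linearized_polys q K = q_associate q ` polys_over K"
proof
  show "linearized_polys q K \<subseteq> q_associate q ` polys_over K"
  proof
    fix f assume "f \<in> linearized_polys q K"
    then obtain n c where f: "f = (\<Sum>i\<le>n. monom (c i) (q ^ i))" and c: "\<forall>i\<le>n. c i \<in> K"
      by (auto simp: linearized_polys_def)
    let ?h = "\<Sum>i\<le>n. monom (c i) i"
    have "coeff ?h k = (if k \<le> n then c k else 0)" for k
      by (simp add: coeff_sum)
    then have "?h \<in> polys_over K" using c assms by (auto simp: polys_over_def)
    moreover have "f = q_associate q ?h"
      by (simp add: f q_associate_sum q_associate_monom)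
    ultimately show "f \<in> q_associate q ` polys_over K" by blast
  qed
qed (auto simp: q_associate_def polys_over_def linearized_polys_def)

text \<open>
  Composing \<open>c X\<^bsup>q\<^sup>i\<^esup>\<close> with \<open>d X\<^bsup>q\<^sup>j\<^esup>\<close> produces the coefficient \<open>c d\<^bsup>q\<^sup>i\<^esup>\<close>, which is \<open>c d\<close> as soon as
  \<open>d \<in> GF q\<close>. The condition sits on the inner factor because in the product of an adjugate with
  its matrix the outer factor is a cofactor and the inner one an entry, whose coefficients are
  known.
\<close>

lemma q_associate_mult:
  fixes h k :: "'p::prime_card mod_ring alg_closure poly"
  assumes q: "q = CARD('p) ^ n" and k: "k \<in> polys_over (GF q)"
  shows "q_associate q (h * k) = pcompose (q_associate q h) (q_associate q k)"
proof -
  have "h * k = (\<Sum>i\<le>degree h. monom (coeff h i) i) * (\<Sum>j\<le>degree k. monom (coeff k j) j)"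
    by (simp add: poly_as_sum_of_monoms)
  also have "\<dots> = (\<Sum>i\<le>degree h. \<Sum>j\<le>degree k. monom (coeff h i * coeff k j) (i + j))"
    by (simp add: sum_product mult_monom)
  finally show ?thesis
    unfolding q_associate_def[of q h] q_associate_def[of q k]
    using pcompose_linearized[OF q, where l = "degree k" and d = "coeff k"
        and n = "degree h" and c = "coeff h"] k
    by (simp add: polys_over_def q_associate_sum q_associate_monom)
qed

lemma poly_q_associate_sum:
  fixes h :: "'p::prime_card mod_ring alg_closure poly"
  assumes q: "q = CARD('p) ^ n"
  shows "poly (q_associate q h) (\<Sum>j\<in>J. y j) = (\<Sum>j\<in>J. poly (q_associate q h) (y j))"
proof -
  have *: "(\<Sum>j\<in>J. y j) ^ q ^ i = (\<Sum>j\<in>J. y j ^ q ^ i)" for i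
    by (rule freshmans_dream_sum'[where n = "n * i"])
       (use prime_card[where 'a='p] in \<open>auto simp: q power_mult\<close>)
  show ?thesis
    by (simp add: q_associate_def poly_sum poly_monom * sum_distrib_left)
       (rule sum.swap)
qed

text \<open>
  Taking \<open>r\<close>-th powers is a field endomorphism that fixes the coefficients of \<open>h\<close>.
\<close>

lemma poly_power_polys_over_GF:
  fixes h :: "'p::prime_card mod_ring alg_closure poly"
  assumes r: "r = CARD('p) ^ e" and h: "h \<in> polys_over (GF r)"
  shows "poly h z ^ r ^ i = poly h (z ^ r ^ i)"
proof -
  have "poly h z ^ r ^ i = (\<Sum>j\<le>degree h. (coeff h j * z ^ j) ^ r ^ i)"
    unfolding poly_altdef
    by (rule freshmans_dream_sum'[where n = "e * i"])
       (use prime_card[where 'a='p] in \<open>auto simp: r power_mult\<close>)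
  also have "\<dots> = (\<Sum>j\<le>degree h. coeff h j * (z ^ r ^ i) ^ j)"
    using h by (intro sum.cong)
      (auto simp: polys_over_def power_mult_distrib GF_pow_pow mult.commute simp flip: power_mult)
  finally show ?thesis by (simp add: poly_altdef)
qed

text \<open>
  The map \<open>q_associate q\<close> is a ring homomorphism from polynomials over \<open>GF q\<close> to linearized
  polynomials under composition, so it can be pulled out of the Leibniz formula. This is where
  the coefficients of the entries have to lie in \<open>GF q\<close>: both the carrier conditions and
  multiplicativity depend on it.
\<close>

lemma ring_det_q_associate:
  fixes N :: "'p::prime_card mod_ring alg_closure poly mat"
  assumes q: "q = CARD('p) ^ n" "n \<ge> 1"
    and N: "N \<in> carrier_mat m m"
    and over: "\<And>i j. i < m \<Longrightarrow> j < m \<Longrightarrow> N $$ (i, j) \<in> polys_over (GF q)"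
    and M: "\<And>i j. i < m \<Longrightarrow> j < m \<Longrightarrow> M i j = q_associate q (N $$ (i, j))"
  shows "ring_det (linearized_ring q) m M = q_associate q (det N)"
proof -
  let ?R = "linearized_ring q :: 'p mod_ring alg_closure poly ring"
  interpret R: cring ?R by (rule cring_linearized_ring[OF q])
  note closed = polys_over_GF_closed[OF q] polys_over_GF_prod_closed[OF q]
  have carr: "q_associate q h \<in> carrier ?R" if "h \<in> polys_over (GF q)"
    for h :: "'p mod_ring alg_closure poly"
    using that by (auto simp: linearized_ring_def linearized_polys_eq_image GF_closed[OF q])
  have sel: "f \<otimes>\<^bsub>?R\<^esub> g = pcompose f g" "f \<oplus>\<^bsub>?R\<^esub> g = f + g" "\<zero>\<^bsub>?R\<^esub> = 0"
    "\<one>\<^bsub>?R\<^esub> = q_associate q 1" for f g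
    by (simp_all add: linearized_ring_def q_associate_1)
  have minus_one: "\<ominus>\<^bsub>?R\<^esub> \<one>\<^bsub>?R\<^esub> = q_associate q (- 1)"
    by (rule R.minus_equality)
       (use carr[of 1] carr[of "- 1"] closed in \<open>simp_all add: sel q_associate_uminus\<close>)
  have finprod: "(\<Otimes>\<^bsub>?R\<^esub>i\<in>I. q_associate q (h i)) = q_associate q (\<Prod>i\<in>I. h i)"
    if "finite I" "\<And>i. i \<in> I \<Longrightarrow> h i \<in> polys_over (GF q)"
    for I :: "nat set" and h :: "nat \<Rightarrow> 'p mod_ring alg_closure poly"
    using that
  proof (induction I rule: finite_induct)
    case (insert i I)
    then have "(\<Otimes>\<^bsub>?R\<^esub>j\<in>insert i I. q_associate q (h j))
        = pcompose (q_associate q (h i)) (q_associate q (\<Prod>j\<in>I. h j))"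
      using carr by (simp add: R.finprod_insert Pi_def sel)
    then show ?case
      using insert closed(8)[of I h] q_associate_mult[OF q(1), of "prod h I" "h i"] by simp
  qed (simp add: sel)
  have finsum: "(\<Oplus>\<^bsub>?R\<^esub>\<sigma>\<in>P. q_associate q (h \<sigma>)) = q_associate q (\<Sum>\<sigma>\<in>P. h \<sigma>)"
    if "finite P" "\<And>\<sigma>. \<sigma> \<in> P \<Longrightarrow> h \<sigma> \<in> polys_over (GF q)"
    for P :: "(nat \<Rightarrow> nat) set" and h :: "(nat \<Rightarrow> nat) \<Rightarrow> 'p mod_ring alg_closure poly"
    using that
    by (induction P rule: finite_induct)
       (use carr in \<open>simp_all add: R.finsum_insert Pi_def sel q_associate_add\<close>)
  let ?P = "{\<sigma>. \<sigma> permutes {..<m}}"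
  let ?prod = "\<lambda>\<sigma>. \<Prod>i\<in>{..<m}. N $$ (i, \<sigma> i)"
  have entry: "N $$ (i, \<sigma> i) \<in> polys_over (GF q)" "M i (\<sigma> i) = q_associate q (N $$ (i, \<sigma> i))"
    if "\<sigma> \<in> ?P" "i \<in> {..<m}" for \<sigma> i
    using that permutes_in_image[of \<sigma> "{..<m}" i] over M by auto
  have summand: "(if evenperm \<sigma> then \<one>\<^bsub>?R\<^esub> else \<ominus>\<^bsub>?R\<^esub> \<one>\<^bsub>?R\<^esub>) \<otimes>\<^bsub>?R\<^esub> (\<Otimes>\<^bsub>?R\<^esub>i\<in>{..<m}. M i (\<sigma> i))
      = q_associate q (signof \<sigma> * ?prod \<sigma>)" if "\<sigma> \<in> ?P" for \<sigma>
  proof -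
    have "(\<Otimes>\<^bsub>?R\<^esub>i\<in>{..<m}. M i (\<sigma> i)) = (\<Otimes>\<^bsub>?R\<^esub>i\<in>{..<m}. q_associate q (N $$ (i, \<sigma> i)))"
      by (rule R.finprod_cong') (use entry[OF that] carr in \<open>auto simp: Pi_def\<close>)
    also have "\<dots> = q_associate q (?prod \<sigma>)"
      by (rule finprod) (use entry[OF that] in auto)
    finally have "(\<Otimes>\<^bsub>?R\<^esub>i\<in>{..<m}. M i (\<sigma> i)) = q_associate q (?prod \<sigma>)" .
    moreover have "?prod \<sigma> \<in> polys_over (GF q)"
      by (rule closed) (use entry[OF that] in auto)
    ultimately show ?thesis
      using q_associate_mult[OF q(1), of "?prod \<sigma>" 1] q_associate_mult[OF q(1), of "?prod \<sigma>" "- 1"]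
      unfolding minus_one by (simp add: sel sign_def)
  qed
  have over_summand: "signof \<sigma> * ?prod \<sigma> \<in> polys_over (GF q)" if "\<sigma> \<in> ?P" for \<sigma>
    using closed(8)[of "{..<m}" "\<lambda>i. N $$ (i, \<sigma> i)"] entry(1)[OF that] closed(4)
    by (auto simp: sign_def)
  have "ring_det ?R m M = (\<Oplus>\<^bsub>?R\<^esub>\<sigma>\<in>?P. q_associate q (signof \<sigma> * ?prod \<sigma>))"
    unfolding ring_det_def
    by (rule R.finsum_cong') (use summand over_summand carr in \<open>auto simp: Pi_def\<close>)
  also have "\<dots> = q_associate q (\<Sum>\<sigma>\<in>?P. signof \<sigma> * ?prod \<sigma>)"
    by (rule finsum) (use over_summand in \<open>auto simp: finite_permutations\<close>)
  also have "(\<Sum>\<sigma>\<in>?P. signof \<sigma> * ?prod \<sigma>) = det N"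
    using det_def'[OF N] by (simp add: atLeast0LessThan)
  finally show ?thesis .
qed

section \<open>Kernel vectors and determinants\<close>

text \<open>
  Polynomials act on the algebraic closure through evaluation of their \<open>q\<close>-associates; this action
  is additive in the argument, and products act as composites. So the identity
  \<open>adj N * N = det N * I\<close> can be applied to a vector \<open>v\<close> killed by \<open>N\<close>, as in linear algebra over
  a commutative ring.
\<close>

lemma det_annihilates_kernel:
  fixes N :: "'p::prime_card mod_ring alg_closure poly mat"
  assumes q: "q = CARD('p) ^ n" "n \<ge> 1"
    and N: "N \<in> carrier_mat m m"
    and over: "\<And>i j. i < m \<Longrightarrow> j < m \<Longrightarrow> N $$ (i, j) \<in> polys_over (GF q)"
    and ker: "\<And>i. i < m \<Longrightarrow> (\<Sum>j<m. poly (q_associate q (N $$ (i, j))) (v j)) = 0"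
    and l: "l < m"
  shows "poly (q_associate q (det N)) (v l) = 0"
proof -
  let ?act = "\<lambda>h. poly (q_associate q h)"
  let ?A = "adj_mat N"
  note A = adj_mat[OF N]
  have entry: "(\<Sum>i<m. ?A $$ (l, i) * N $$ (i, j)) = (if j = l then det N else 0)" if "j < m" for j
  proof -
    have "(?A * N) $$ (l, j) = (\<Sum>i<m. ?A $$ (l, i) * N $$ (i, j))"
      using A(1) N l that by (simp add: scalar_prod_def atLeast0LessThan)
    moreover have "(?A * N) $$ (l, j) = (if j = l then det N else 0)"
      using A(3) l that by simp
    ultimately show ?thesis by simp
  qed
  have "?act (det N) (v l) = (\<Sum>j<m. ?act (if j = l then det N else 0) (v j))"
    using l by (simp add: if_distrib[of "q_associate q"] if_distrib[of "\<lambda>h. poly h _"] cong: if_cong)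
  also have "\<dots> = (\<Sum>j<m. \<Sum>i<m. ?act (?A $$ (l, i)) (?act (N $$ (i, j)) (v j)))"
    using over by (intro sum.cong refl)
      (simp add: q_associate_sum poly_sum q_associate_mult[OF q(1)] poly_pcompose flip: entry)
  also have "\<dots> = (\<Sum>i<m. ?act (?A $$ (l, i)) (\<Sum>j<m. ?act (N $$ (i, j)) (v j)))"
    by (subst sum.swap) (simp add: poly_q_associate_sum[OF q(1)])
  also have "\<dots> = (\<Sum>i<m. ?act (?A $$ (l, i)) 0)"
    using ker by simp
  also have "\<dots> = 0"
    using poly_q_associate_sum[OF q(1), of _ "\<lambda>_. 0" "{}"] by simp
  finally show ?thesis .
qed

section \<open>Descent of a determinant by a twisted cyclic shift\<close>

text \<open>
  The companion matrix of \<open>Y\<^sup>m - T\<close>, where \<open>T = [:0, 1:]\<close>: multiplication from the left moves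
  the rows up by one place and multiplies the row that wraps around by \<open>T\<close>.
\<close>

definition twisted_shift :: "nat \<Rightarrow> 'a::comm_ring_1 poly mat" where
  "twisted_shift m = mat m m (\<lambda>(i, j).
     if j = Suc i then 1 else if Suc i = m \<and> j = 0 then [:0, 1:] else 0)"

lemma twisted_shift_carrier [simp]: "twisted_shift m \<in> carrier_mat m m"
  by (simp add: twisted_shift_def)

lemma twisted_shift_mult_left:
  assumes A: "A \<in> carrier_mat m m" and ij: "i < m" "j < m"
  shows "(twisted_shift m * A) $$ (i, j)
         = (if Suc i < m then A $$ (Suc i, j) else [:0, 1:] * A $$ (0, j))"
proof -
  have "(twisted_shift m * A) $$ (i, j)
      = (\<Sum>k<m. (if k = Suc i then 1 else if Suc i = m \<and> k = 0 then [:0, 1:] else 0) * A $$ (k, j))"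
    using A ij by (simp add: twisted_shift_def scalar_prod_def atLeast0LessThan)
  also have "\<dots> = (\<Sum>k<m. if k = (if Suc i < m then Suc i else 0)
      then (if Suc i < m then A $$ (Suc i, j) else [:0, 1:] * A $$ (0, j)) else 0)"
    using ij by (intro sum.cong) auto
  also have "\<dots> = (if Suc i < m then A $$ (Suc i, j) else [:0, 1:] * A $$ (0, j))"
    using ij by (subst sum.delta) auto
  finally show ?thesis .
qed

lemma twisted_shift_mult_right:
  assumes A: "A \<in> carrier_mat m m" and ij: "i < m" "j < m"
  shows "(A * twisted_shift m) $$ (i, j)
         = (if j = 0 then A $$ (i, m - 1) * [:0, 1:] else A $$ (i, j - 1))"
proof -
  have "(A * twisted_shift m) $$ (i, j)
      = (\<Sum>k<m. A $$ (i, k) * (if j = Suc k then 1 else if Suc k = m \<and> j = 0 then [:0, 1:] else 0))"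
    using A ij by (simp add: twisted_shift_def scalar_prod_def atLeast0LessThan)
  also have "\<dots> = (\<Sum>k<m. if k = (if j = 0 then m - 1 else j - 1)
      then (if j = 0 then A $$ (i, m - 1) * [:0, 1:] else A $$ (i, j - 1)) else 0)"
    using ij by (intro sum.cong) auto
  also have "\<dots> = (if j = 0 then A $$ (i, m - 1) * [:0, 1:] else A $$ (i, j - 1))"
    using ij by (subst sum.delta) auto
  finally show ?thesis .
qed

text \<open>
  Moving the rows back down, and multiplying by \<open>T\<close> all of them but the one that wraps around,
  inverts the shift up to the scalar \<open>T\<close>, so the determinant divides \<open>T\<^sup>m\<close>. This avoids the sign in the exact value.
\<close>

lemma det_twisted_shift_nonzero: "det (twisted_shift m :: 'a::idom poly mat) \<noteq> 0"
proof -
  let ?S = "twisted_shift m :: 'a poly mat"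
  let ?B = "mat m m (\<lambda>(i, j). if i = Suc j then [:0, 1:] else if i = 0 \<and> Suc j = m then 1 else 0)
    :: 'a poly mat"
  have "?S * ?B = [:0, 1:] \<cdot>\<^sub>m 1\<^sub>m m"
  proof (rule eq_matI)
    fix i j assume "i < dim_row ([:0, 1:] \<cdot>\<^sub>m 1\<^sub>m m :: 'a poly mat)"
      "j < dim_col ([:0, 1:] \<cdot>\<^sub>m 1\<^sub>m m :: 'a poly mat)"
    then show "(?S * ?B) $$ (i, j) = ([:0, 1:] \<cdot>\<^sub>m 1\<^sub>m m) $$ (i, j)"
      by (subst twisted_shift_mult_left) auto
  qed (simp_all add: twisted_shift_def)
  then have "det ?S * det ?B = [:0, 1:] ^ m"
    by (subst det_mult[symmetric, where n = m]) simp_all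
  moreover have "([:0, 1:] :: 'a poly) ^ m \<noteq> 0" by simp
  ultimately have "det ?S * det ?B \<noteq> 0" by (rule ssubst)
  then show ?thesis by (rule mult_not_zero[THEN conjunct1])
qed

lemma comm_ring_hom_frobenius:
  assumes r: "r = CARD('p::prime_card) ^ e"
  shows "comm_ring_hom (\<lambda>x :: 'p mod_ring alg_closure. x ^ r)"
proof
  have "r > 0" using prime_card[where 'a='p] prime_gt_0_nat r by simp
  then show "(0 :: 'p mod_ring alg_closure) ^ r = 0" by (simp add: power_0_left)
qed (simp_all add: r add_power_closure power_mult_distrib)

text \<open>
  Coefficientwise \<open>r\<close>-th powers form a ring endomorphism, hence commute with \<open>det\<close>. By the
  hypothesis \<open>N\<close> and its image have the same determinant after multiplication by
  \<open>det (twisted_shift m)\<close>, which can be cancelled. So the coefficients of \<open>det N\<close> are fixed by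
  \<open>r\<close>-th powers, the defining property of \<open>GF r\<close>.
\<close>

lemma det_over_GF_if_shift_commutes:
  fixes N :: "'p::prime_card mod_ring alg_closure poly mat"
  assumes r: "r = CARD('p) ^ e"
    and N: "N \<in> carrier_mat m m"
    and comm: "twisted_shift m * N = map_mat (map_poly (\<lambda>x. x ^ r)) N * twisted_shift m"
  shows "det N \<in> polys_over (GF r)"
proof -
  interpret frob: comm_ring_hom "\<lambda>x :: 'p mod_ring alg_closure. x ^ r"
    by (rule comm_ring_hom_frobenius[OF r])
  interpret map_frob: map_poly_comm_ring_hom "\<lambda>x :: 'p mod_ring alg_closure. x ^ r" ..
  let ?S = "twisted_shift m :: 'p mod_ring alg_closure poly mat"
  let ?F = "map_poly (\<lambda>x :: 'p mod_ring alg_closure. x ^ r)"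
  have "det ?S * det N = ?F (det N) * det ?S"
    using arg_cong[OF comm, of det] N
    by (simp add: det_mult[where n = m])
  then have fixed: "?F (det N) = det N"
    using det_twisted_shift_nonzero[of m, where 'a = "'p mod_ring alg_closure"]
    by (auto simp: mult.commute)
  have "coeff (det N) i ^ r = coeff (det N) i" for i
    using arg_cong[OF fixed, of "\<lambda>h. coeff h i"] by simp
  then show ?thesis by (simp add: polys_over_def GF_def)
qed

section \<open>The determinant attached to a kernel equation\<close>

theorem theorem2p1:
  fixes r m q :: nat
    and a :: "nat \<Rightarrow> 'p::prime_card mod_ring alg_closure"
    and f :: "nat \<Rightarrow> 'p mod_ring alg_closure poly"
    and M :: "nat \<Rightarrow> nat \<Rightarrow> 'p mod_ring alg_closure poly"
  assumes r: "\<exists>e\<ge>1. r = CARD('p) ^ e"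
    and m: "m \<ge> 1"
    and q: "q = r ^ m"
    and a: "\<And>i. i < m \<Longrightarrow> a i \<in> GF q"
    and f: "\<And>i. i < m \<Longrightarrow> f i \<in> linearized_polys q (GF r)"
    and M: "\<And>i j. i < m \<Longrightarrow> j < m \<Longrightarrow>
              M i j = (if i \<le> j then smult (a (j - i) ^ r ^ i) (f (j - i))
                       else smult (a (m + j - i) ^ r ^ i) (pcompose (f (m + j - i)) (monom 1 q)))"
  shows "ring_det (linearized_ring q) m M \<in> linearized_polys q (GF r) \<and>
         (\<forall>z. (\<Sum>i<m. a i * poly (f i) z ^ r ^ i) = 0 \<longrightarrow>
              poly (ring_det (linearized_ring q) m M) z = 0)"
proof -
  obtain e where e: "r = CARD('p) ^ e" "e \<ge> 1" using r by blast
  have qe: "q = CARD('p) ^ (e * m)" "e * m \<ge> 1"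
    using q e(1) mult_le_mono[OF e(2) m] by (simp_all add: power_mult)
  have "\<forall>k. \<exists>h. k < m \<longrightarrow> h \<in> polys_over (GF r) \<and> f k = q_associate q h"
    using f linearized_polys_eq_image[of "GF r" q] GF_closed(1)[OF e] by blast
  then obtain g where g: "\<And>k. k < m \<Longrightarrow> g k \<in> polys_over (GF r)"
    and fg: "\<And>k. k < m \<Longrightarrow> f k = q_associate q (g k)"
    by metis
  have gq: "g k \<in> polys_over (GF q)" if "k < m" for k
    using g[OF that] unfolding q by (auto simp: polys_over_def GF_mono_power)
  define T :: "'p mod_ring alg_closure poly" where "T = [:0, 1:]"
  define N where "N = mat m m (\<lambda>(i, j).
    if i \<le> j then smult (a (j - i) ^ r ^ i) (g (j - i))
    else smult (a (m + j - i) ^ r ^ i) (g (m + j - i) * T))"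
  have N: "N \<in> carrier_mat m m" by (simp add: N_def)
  note closed = polys_over_GF_closed[OF qe, folded T_def]
  have over: "N $$ (i, j) \<in> polys_over (GF q)" if "i < m" "j < m" for i j
    using that by (auto simp: N_def intro!: closed GF_power_closed a gq)
  have T: "q_associate q T = monom 1 q" by (simp add: T_def q_associate_X)
  have MN: "M i j = q_associate q (N $$ (i, j))" if "i < m" "j < m" for i j
    using that closed(3)
    by (simp add: M N_def fg q_associate_smult q_associate_mult[OF qe(1)] T)
  have det: "ring_det (linearized_ring q) m M = q_associate q (det N)"
    by (rule ring_det_q_associate[OF qe N over MN])

  have over_r: "det N \<in> polys_over (GF r)"
  proof (rule det_over_GF_if_shift_commutes[OF e(1) N])
    let ?F = "map_poly (\<lambda>x :: 'p mod_ring alg_closure. x ^ r)"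
    interpret frob: comm_ring_hom "\<lambda>x :: 'p mod_ring alg_closure. x ^ r"
      by (rule comm_ring_hom_frobenius[OF e(1)])
    interpret map_frob: map_poly_comm_ring_hom "\<lambda>x :: 'p mod_ring alg_closure. x ^ r" ..
    have Fg: "?F (g k) = g k" if "k < m" for k
      using g[OF that] by (intro poly_eqI) (simp add: polys_over_def GF_def)
    have FT: "?F T = T" by (simp add: T_def)
    have Fs: "?F (smult (c ^ r ^ i) h) = smult (c ^ r ^ Suc i) (?F h)" for c h i
      by (rule poly_eqI) (simp add: power_mult_distrib mult.commute flip: power_mult)
    have FN: "?F (N $$ (i, j)) = (if i \<le> j then smult (a (j - i) ^ r ^ Suc i) (g (j - i))
        else smult (a (m + j - i) ^ r ^ Suc i) (g (m + j - i) * T))"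
      if "i < m" "j < m" for i j
      using that by (simp add: N_def Fs Fg map_frob.hom_mult FT del: power_Suc)
    \<comment> \<open>The cycle closes: the last row of the image has the exponent \<open>r\<^sup>m\<close>, row 0 has exponent 1.\<close>
    have aq: "a k ^ r ^ m = a k" if "k < m" for k
      using a[OF that] by (simp add: GF_def q)
    show "twisted_shift m * N = map_mat ?F N * twisted_shift m"
    proof (rule eq_matI)
      fix i j assume "i < dim_row (map_mat ?F N * twisted_shift m)"
        "j < dim_col (map_mat ?F N * twisted_shift m)"
      then have ij: "i < m" "j < m" using N by (auto simp: twisted_shift_def)
      then have i_le: "i \<le> m - Suc 0" by simp
      have "(map_mat ?F N * twisted_shift m) $$ (i, j)
          = (if j = 0 then ?F (N $$ (i, m - 1)) * T else ?F (N $$ (i, j - 1)))"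
        using ij N by (subst twisted_shift_mult_right) (auto simp: T_def)
      also have "\<dots> = (if Suc i < m then N $$ (Suc i, j) else T * N $$ (0, j))"
      proof (cases "Suc i < m")
        case True
        then show ?thesis
          using ij
          by (cases j; simp add: FN i_le del: power_Suc; simp add: N_def del: power_Suc)
      next
        case False
        then have "Suc i = m" using ij by simp
        then show ?thesis
          using ij aq
          by (cases j; simp add: FN del: power_Suc; auto simp: N_def mult.commute simp del: power_Suc)
      qed
      also have "\<dots> = (twisted_shift m * N) $$ (i, j)"
        by (simp only: twisted_shift_mult_left[OF N ij] T_def)
      finally show "(twisted_shift m * N) $$ (i, j) = (map_mat ?F N * twisted_shift m) $$ (i, j)"
        by (rule sym)
    qed (use N in \<open>simp_all add: twisted_shift_def\<close>)
  qed

  have vanish: "poly (q_associate q (det N)) z = 0"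
    if z: "(\<Sum>k<m. a k * poly (f k) z ^ r ^ k) = 0" for z
  proof -
    have f_over: "f k \<in> polys_over (GF r)" if "k < m" for k
      using fg[OF that] g[OF that] GF_closed(1)[OF e]
      by (auto simp: polys_over_def q_associate_def coeff_sum intro!: GF_sum_closed[OF e])
    have "(\<Sum>j<m. poly (q_associate q (N $$ (i, j))) (z ^ r ^ j)) = 0" if i: "i < m" for i
    proof -
      let ?t = "\<lambda>k. a k ^ r ^ i * poly (f k) (z ^ r ^ (k + i))"
      have "0 = (\<Sum>k<m. a k * poly (f k) z ^ r ^ k) ^ r ^ i"
        using z e prime_card[where 'a='p] prime_gt_0_nat by (simp add: power_0_left)
      also have "\<dots> = (\<Sum>k<m. (a k * poly (f k) z ^ r ^ k) ^ r ^ i)"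
        by (rule freshmans_dream_sum'[where n = "e * i"])
           (use prime_card[where 'a='p] in \<open>auto simp: e power_mult\<close>)
      also have "\<dots> = (\<Sum>k<m. ?t k)"
      proof (rule sum.cong[OF refl])
        fix k assume "k \<in> {..<m}"
        then have "(poly (f k) z ^ r ^ k) ^ r ^ i = poly (f k) (z ^ r ^ (k + i))"
          using poly_power_polys_over_GF[OF e(1) f_over, of k z "k + i"]
          by (simp add: power_add power_mult)
        then show "(a k * poly (f k) z ^ r ^ k) ^ r ^ i = ?t k"
          by (simp only: power_mult_distrib)
      qed
      \<comment> \<open>Column \<open>j\<close> of row \<open>i\<close> collects the index \<open>k\<close> with \<open>k + i\<close> congruent to \<open>j\<close> modulo \<open>m\<close>.\<close>
      also have "\<dots> = (\<Sum>j<m. ?t (if i \<le> j then j - i else m + j - i))"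
        by (rule sum.reindex_bij_witness[where i = "\<lambda>j. if i \<le> j then j - i else m + j - i"
              and j = "\<lambda>k. if k + i < m then k + i else k + i - m"])
           (use i in auto)
      also have "\<dots> = (\<Sum>j<m. poly (q_associate q (N $$ (i, j))) (z ^ r ^ j))"
      proof (rule sum.cong[OF refl])
        fix j assume "j \<in> {..<m}"
        then have j: "j < m" by simp
        have "(z ^ r ^ j) ^ q = z ^ r ^ (m + j)"
          by (simp add: q power_add mult.commute flip: power_mult)
        then show "?t (if i \<le> j then j - i else m + j - i)
            = poly (q_associate q (N $$ (i, j))) (z ^ r ^ j)"
          using i j by (simp add: M poly_pcompose poly_monom flip: MN)
      qed
      finally show ?thesis by simp
    qed
    \<comment> \<open>The entry of index 0 of the kernel vector is \<open>z ^ r ^ 0 = z\<close>.\<close>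
    from det_annihilates_kernel[OF qe N over this, of 0] m show ?thesis by simp
  qed

  show ?thesis
    using over_r vanish GF_closed(1)[OF e] by (auto simp: det linearized_polys_eq_image)
qed

end
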